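(* Consider the piecewise-constant-control discretization of the two-qubit system described in the context, with the robustness expansion bypassed, i.e. $N_\alpha=N_\beta=0$. Let $\vec x_0,\vec x_T\in\mathbb R^{32}$ be an initial and a target state, let $\vec u\in\mathbb R^{4K}$ be a current control vector, let $\vec x_K=\vec x_K(\vec u)$ be the corresponding terminal state, let $Q=Q(\vec u)\in\mathbb R^{32\times 4K}$ be the (approximate) Jacobian of $\vec x_K$ with respect to $\vec u$ defined in the context, and let $\lambda>0$. Suppose all restrictions on the control signal (bounds on amplitude and rate of change) are removed, so that $\delta\vec u$ ranges over all of $\mathbb R^{4K}$. Then: (a) The solution of the quadratic program $$\text{maximize over } \delta\vec u\in\mathbb R^{4K}:\quad \langle \vec x_T\,|\,Q\,\delta\vec u\rangle-\tfrac12\lambda\|\delta\vec u\|^2$$ is the gradient update $$\delta\vec u=\frac1\lambda\,Q'\vec x_T,$$ i.e. the gradient-ascent step, with step size $1/\lambda$, for the objective $\vec u\mapsto\langle\vec x_T|\vec x_K(\vec u)\rangle$, where the derivatives of $\vec x_K$ are computed with the approximation defining $Q$. (b) The solution of the quadratic program $$\text{minimize over } \delta\vec u\in\mathbb R^{4K}:\quad \tfrac12\|Q\,\delta\vec u+\vec x_K-\vec x_T\|^2+\tfrac12\lambda\|\delta\vec u\|^2$$ is the Levenberg update $$\delta\vec u=-\left(Q'Q+\lambda I\right)^{-1}Q'\left(\vec x_K-\vec x_T\right),$$ where $I$ is the $4K\times 4K$ identity matrix.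
   Context: Notation: $M'$ denotes the transpose, $\langle\cdot|\cdot\rangle$ and $\|\cdot\|$ the standard Euclidean inner product and norm, $\otimes$ the Kronecker product, $I_n$ the $n\times n$ identity matrix, and $d=4$. System matrices. Let $\sigma^x,\sigma^y,\sigma^z$ be the Pauli matrices, $\sigma_1^m=\sigma^m\otimes I_2$, $\sigma_2^m=I_2\otimes\sigma^m$. Let $J\in\mathbb R$ (interaction strength) and $\gamma\ge 0$ (decoherence rate), and set $\Gamma_z=\sqrt\gamma(\sigma_1^z+\sigma_2^z)/2$, $\Gamma_\pm=\sqrt\gamma(\sigma_1^x+\sigma_2^x)/2\pm i\sqrt\gamma(\sigma_1^y+\sigma_2^y)/2$. For $n=1,2$ define the real $16\times16$ matrices $$\tilde{\mathcal B}_n^x=\tfrac12\left(I_d\otimes\sigma_n^x-(\sigma_n^x)'\otimes I_d\right),\qquad \tilde{\mathcal B}_n^y=-\tfrac i2\left(I_d\otimes\sigma_n^y-(\sigma_n^y)'\otimes I_d\right),$$ $$\tilde{\mathcal A}^L=\sum_{m\in\{z,+,-\}}\Gamma_m\otimes\Gamma_m-\tfrac12\left(I_d\otimes\Gamma_m'\Gamma_m+\Gamma_m'\Gamma_m\otimes I_d\right),\qquad \tilde{\mathcal A}^z=\tfrac J4\left(I_d\otimes\sigma_1^z\sigma_2^z-(\sigma_1^z\sigma_2^z)'\otimes I_d\right),$$ (the sum over $m$ applies to the whole expression) and the real $32\times 32$ matrices $$\mathcal A=\begin{bmatrix}\tilde{\mathcal A}^L&-\tilde{\mathcal A}^z\\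 \tilde{\mathcal A}^z&\tilde{\mathcal A}^L\end{bmatrix},\quad \mathcal B_n^x=\begin{bmatrix}0&-\tilde{\mathcal B}_n^x\\ \tilde{\mathcal B}_n^x&0\end{bmatrix},\quad \mathcal B_n^y=\mathrm{diag}(\tilde{\mathcal B}_n^y,\tilde{\mathcal B}_n^y).$$ Robust system and its truncation. The full model has uncertain parameters $\alpha\in[\alpha_{\min},\alpha_{\max}]$, $\beta\in[\beta_{\min},\beta_{\max}]$ multiplying $\mathcal A$ and the control terms, respectively, and the state is expanded in normalized Legendre polynomials in $\alpha$ and $\beta$ (rescaled to $[-1,1]$) up to degrees $N_\alpha$ and $N_\beta$. The vector $\vec x(t)$ of expansion coefficients satisfies $$\frac{d\vec x}{dt}=A\vec x+\left(u_1^xB_1^x+u_1^yB_1^y+u_2^xB_2^x+u_2^yB_2^y\right)\vec x,\qquad \vec x(0)=\vec x_0,$$ with $A=C_\alpha\otimes I_{N_\beta+1}\otimes\mathcal A$ and $B_n^m=I_{N_\alpha+1}\otimes C_\beta\otimes\mathcal B_n^m$, where $C_\xi$ is the $(N_\xi+1)\times(N_\xi+1)$ symmetric tridiagonal matrix with diagonal entries $\overline\xi=(\xi_{\max}+\xi_{\min})/2$ and off-diagonal entries $c_p(\xi_{\max}-\xi_{\min})/2$, $p=0,\dots,N_\xi-1$, $c_p=(p+1)/\sqrt{(2p+3)(2p+1)}$. When $N_\alpha=N_\beta=0$ one has $C_\alpha=[\overline\alpha]$, $C_\beta=[\overline\beta]$, so $A=\overline\alpha\,\mathcal A$, $B_n^m=\overline\beta\,\mathcal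 B_n^m$ and $\vec x(t)\in\mathbb R^{32}$. Discretization. Let $T>0$, $K\ge1$ an integer, $\Delta t=T/K$, $t_k=k\Delta t$. The controls are constant on each $[t_k,t_{k+1})$; write $\vec u_k=[u_1^x(t_k),u_1^y(t_k),u_2^x(t_k),u_2^y(t_k)]'$ and $\vec u=[\vec u_0',\dots,\vec u_{K-1}']'\in\mathbb R^{4K}$. Let $$U_k=\exp\left(\Delta t\Big(A+\sum_{n=1}^2u_n^x(t_k)B_n^x+u_n^y(t_k)B_n^y\Big)\right),\qquad \vec x_K=U_{K-1}U_{K-2}\cdots U_1U_0\vec x_0.$$ Approximate Jacobian. The derivative of $U_k$ is approximated by $\partial U_k/\partial u_n^m(t_k)\approx\Delta t\,B_n^mU_k$, so that the derivative of the terminal state is computed as $$\frac{\partial\vec x_K}{\partial u_n^m(t_k)}:=\Delta t\,U_{K-1}\cdots U_{k+1}B_n^mU_kU_{k-1}\cdots U_0\vec x_0 .$$ Set $Q_k=\left[\frac{\partial\vec x_K}{\partial u_1^x(t_k)},\frac{\partial\vec x_K}{\partial u_1^y(t_k)},\frac{\partial\vec x_K}{\partial u_2^x(t_k)},\frac{\partial\vec x_K}{\partial u_2^y(t_k)}\right]$ for $k=0,\dots,K-1$ and $Q=[Q_0,Q_1,\dots,Q_{K-1}]$. *)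

theory Defs
  imports
    "HOL-Analysis.Derivative"
    "Jordan_Normal_Form.Gauss_Jordan_Elimination"
begin

unbundle no inner_syntax and no vec_syntax

definition kronecker :: "'a :: times mat \<Rightarrow> 'a mat \<Rightarrow> 'a mat" (infixl \<open>\<otimes>\<^sub>k\<close> 70) where
  "A \<otimes>\<^sub>k B = mat (dim_row A * dim_row B) (dim_col A * dim_col B)
     (\<lambda>(i, j). A $$ (i div dim_row B, j div dim_col B) * B $$ (i mod dim_row B, j mod dim_col B))"

definition euclid_norm :: "real vec \<Rightarrow> real" where
  "euclid_norm v = sqrt (v \<bullet> v)"

definition mat_exp :: "real mat \<Rightarrow> real mat" where
  "mat_exp M = mat (dim_row M) (dim_row M) (\<lambda>(i, j). \<Sum>r. (M ^\<^sub>m r) $$ (i, j) / fact r)"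

text \<open>The entrywise exponential series converges, so the infinite sum above is never a
  default value.\<close>

lemma mat_exp_summable:
  fixes M :: "real mat"
  assumes M: "M \<in> carrier_mat n n" and i: "i < n" and j: "j < n"
  shows "summable (\<lambda>r. (M ^\<^sub>m r) $$ (i, j) / fact r)"
proof -
  define c where "c = (\<Sum>i<n. \<Sum>j<n. \<bar>M $$ (i, j)\<bar>)"
  have c: "\<bar>M $$ (i, j)\<bar> \<le> c" if "i < n" "j < n" for i j
  proof -
    have "\<bar>M $$ (i, j)\<bar> \<le> (\<Sum>j<n. \<bar>M $$ (i, j)\<bar>)"
      using that by (intro member_le_sum) auto
    also have "\<dots> \<le> c" unfolding c_def
      using that by (intro member_le_sum[of _ _ "\<lambda>i. \<Sum>j<n. \<bar>M $$ (i, j)\<bar>"] sum_nonneg) auto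
    finally show ?thesis .
  qed
  have c0: "c \<ge> 0" unfolding c_def by (intro sum_nonneg) auto
  have bound: "\<bar>(M ^\<^sub>m r) $$ (i, j)\<bar> \<le> (real n * c) ^ r" if "i < n" "j < n" for i j r
    using that
  proof (induction r arbitrary: j)
    case 0
    then show ?case using M by auto
  next
    case (Suc r)
    have P: "M ^\<^sub>m r \<in> carrier_mat n n" using M by (rule pow_carrier_mat)
    have "(M ^\<^sub>m Suc r) $$ (i, j) = (\<Sum>l<n. (M ^\<^sub>m r) $$ (i, l) * M $$ (l, j))"
      using M P Suc.prems by (simp add: scalar_prod_def atLeast0LessThan)
    then have "\<bar>(M ^\<^sub>m Suc r) $$ (i, j)\<bar> \<le> (\<Sum>l<n. \<bar>(M ^\<^sub>m r) $$ (i, l)\<bar> * \<bar>M $$ (l, j)\<bar>)"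
      by (simp only: abs_mult[symmetric] sum_abs)
    also have "\<dots> \<le> (\<Sum>l<n. (real n * c) ^ r * c)"
      using Suc c c0 by (intro sum_mono mult_mono) auto
    also have "\<dots> = (real n * c) ^ Suc r" by simp
    finally show ?case .
  qed
  show ?thesis
  proof (rule summable_comparison_test')
    show "summable (\<lambda>r. inverse (fact r) * (real n * c) ^ r)" by (rule summable_exp)
    show "norm ((M ^\<^sub>m r) $$ (i, j) / fact r) \<le> inverse (fact r) * (real n * c) ^ r" for r
      using bound[OF i j, of r] by (simp add: field_simps)
  qed
qed

datatype axis = PX | PY | PZ

fun pauli :: "axis \<Rightarrow> complex mat" where
  "pauli PX = mat_of_rows_list 2 [[0, 1], [1, 0]]"
| "pauli PY = mat_of_rows_list 2 [[0, - \<i>], [\<i>, 0]]"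
| "pauli PZ = mat_of_rows_list 2 [[1, 0], [0, -1]]"

datatype qubit = Q1 | Q2

fun qubit_pauli :: "qubit \<Rightarrow> axis \<Rightarrow> complex mat" where
  "qubit_pauli Q1 m = pauli m \<otimes>\<^sub>k 1\<^sub>m 2"
| "qubit_pauli Q2 m = 1\<^sub>m 2 \<otimes>\<^sub>k pauli m"

definition collective :: "real \<Rightarrow> axis \<Rightarrow> complex mat" where
  "collective \<gamma> m = complex_of_real (sqrt \<gamma> / 2) \<cdot>\<^sub>m (qubit_pauli Q1 m + qubit_pauli Q2 m)"

datatype channel = Dephase | Plus | Minus

fun jump_op :: "real \<Rightarrow> channel \<Rightarrow> complex mat" where
  "jump_op \<gamma> Dephase = collective \<gamma> PZ"
| "jump_op \<gamma> Plus = collective \<gamma> PX + \<i> \<cdot>\<^sub>m collective \<gamma> PY"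
| "jump_op \<gamma> Minus = collective \<gamma> PX - \<i> \<cdot>\<^sub>m collective \<gamma> PY"

definition ctrl_super_cx :: "qubit \<Rightarrow> axis \<Rightarrow> complex mat" where
  "ctrl_super_cx n m = 1\<^sub>m 4 \<otimes>\<^sub>k qubit_pauli n m - (qubit_pauli n m)\<^sup>T \<otimes>\<^sub>k 1\<^sub>m 4"

definition B_tilde_x_cx :: "qubit \<Rightarrow> complex mat" where
  "B_tilde_x_cx n = (1 / 2) \<cdot>\<^sub>m ctrl_super_cx n PX"

definition B_tilde_y_cx :: "qubit \<Rightarrow> complex mat" where
  "B_tilde_y_cx n = (- \<i> / 2) \<cdot>\<^sub>m ctrl_super_cx n PY"

definition dissipator_cx :: "complex mat \<Rightarrow> complex mat" where
  "dissipator_cx G = G \<otimes>\<^sub>k G - (1 / 2) \<cdot>\<^sub>m (1\<^sub>m 4 \<otimes>\<^sub>k (G\<^sup>T * G) + (G\<^sup>T * G) \<otimes>\<^sub>k 1\<^sub>m 4)"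

definition A_tilde_L_cx :: "real \<Rightarrow> complex mat" where
  "A_tilde_L_cx \<gamma> = dissipator_cx (jump_op \<gamma> Dephase) + dissipator_cx (jump_op \<gamma> Plus)
     + dissipator_cx (jump_op \<gamma> Minus)"

definition A_tilde_z_cx :: "real \<Rightarrow> complex mat" where
  "A_tilde_z_cx J = complex_of_real (J / 4) \<cdot>\<^sub>m
     (1\<^sub>m 4 \<otimes>\<^sub>k (qubit_pauli Q1 PZ * qubit_pauli Q2 PZ)
      - (qubit_pauli Q1 PZ * qubit_pauli Q2 PZ)\<^sup>T \<otimes>\<^sub>k 1\<^sub>m 4)"

text \<open>The four complex matrices above have real entries only (see the lemmas
  \<open>of_real_Re_mat\<close> below); passing to type \<^typ>\<open>real\<close> by taking entrywise real parts loses
  nothing.\<close>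

abbreviation Re_mat :: "complex mat \<Rightarrow> real mat" where
  "Re_mat \<equiv> map_mat Re"

definition B_tilde_x :: "qubit \<Rightarrow> real mat" where
  "B_tilde_x n = Re_mat (B_tilde_x_cx n)"

definition B_tilde_y :: "qubit \<Rightarrow> real mat" where
  "B_tilde_y n = Re_mat (B_tilde_y_cx n)"

definition A_tilde_L :: "real \<Rightarrow> real mat" where
  "A_tilde_L \<gamma> = Re_mat (A_tilde_L_cx \<gamma>)"

definition A_tilde_z :: "real \<Rightarrow> real mat" where
  "A_tilde_z J = Re_mat (A_tilde_z_cx J)"

declare pauli.simps [simp del] qubit_pauli.simps [simp del] jump_op.simps [simp del]

definition real_mat :: "complex mat \<Rightarrow> bool" where
  "real_mat M \<longleftrightarrow> (\<forall>i < dim_row M. \<forall>j < dim_col M. Im (M $$ (i, j)) = 0)"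

lemma dims_kronecker [simp]:
  "dim_row (A \<otimes>\<^sub>k B) = dim_row A * dim_row B" "dim_col (A \<otimes>\<^sub>k B) = dim_col A * dim_col B"
  by (simp_all add: kronecker_def)

lemma dims_pauli [simp]: "dim_row (pauli m) = 2" "dim_col (pauli m) = 2"
  by (cases m; simp add: pauli.simps mat_of_rows_list_def)+

lemma dims_qubit_pauli [simp]:
  "dim_row (qubit_pauli n m) = 4" "dim_col (qubit_pauli n m) = 4"
  by (cases n; simp add: qubit_pauli.simps)+

lemma dims_collective [simp]:
  "dim_row (collective \<gamma> m) = 4" "dim_col (collective \<gamma> m) = 4"
  by (simp_all add: collective_def)

lemma dims_jump_op [simp]: "dim_row (jump_op \<gamma> c) = 4" "dim_col (jump_op \<gamma> c) = 4"
  by (cases c; simp add: jump_op.simps)+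

lemma dims_cx [simp]:
  "dim_row (ctrl_super_cx n m) = 16" "dim_col (ctrl_super_cx n m) = 16"
  "dim_row (dissipator_cx G) = dim_col G * 4" "dim_col (dissipator_cx G) = dim_col G * 4"
  by (simp_all add: ctrl_super_cx_def dissipator_cx_def)

lemma dims_tilde [simp]:
  "B_tilde_x n \<in> carrier_mat 16 16" "B_tilde_y n \<in> carrier_mat 16 16"
  "A_tilde_L \<gamma> \<in> carrier_mat 16 16" "A_tilde_z J \<in> carrier_mat 16 16"
  by (rule carrier_matI; simp add: B_tilde_x_def B_tilde_x_cx_def B_tilde_y_def B_tilde_y_cx_def
      A_tilde_L_def A_tilde_L_cx_def A_tilde_z_def A_tilde_z_cx_def)+

lemma div_mod_less: "i div b < a" "i mod b < b" if "i < a * b" for i a b :: nat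
  using that by (cases "b = 0"; simp add: less_mult_imp_div_less)+

lemma real_mat_kronecker: "real_mat A \<Longrightarrow> real_mat B \<Longrightarrow> real_mat (A \<otimes>\<^sub>k B)"
  by (simp add: real_mat_def kronecker_def div_mod_less)

lemma real_mat_add:
  "real_mat A \<Longrightarrow> real_mat B \<Longrightarrow> dim_row A = dim_row B \<Longrightarrow> dim_col A = dim_col B \<Longrightarrow> real_mat (A + B)"
  and real_mat_minus:
  "real_mat A \<Longrightarrow> real_mat B \<Longrightarrow> dim_row A = dim_row B \<Longrightarrow> dim_col A = dim_col B \<Longrightarrow> real_mat (A - B)"
  and real_mat_smult: "Im c = 0 \<Longrightarrow> real_mat A \<Longrightarrow> real_mat (c \<cdot>\<^sub>m A)"
  and real_mat_one: "real_mat (1\<^sub>m n)"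
  and real_mat_transpose: "real_mat A \<Longrightarrow> real_mat A\<^sup>T"
  and real_mat_mult: "real_mat A \<Longrightarrow> real_mat B \<Longrightarrow> dim_col A = dim_row B \<Longrightarrow> real_mat (A * B)"
  unfolding real_mat_def by (auto simp: scalar_prod_def intro!: sum.neutral)

lemmas real_mat_intros = real_mat_kronecker real_mat_add real_mat_minus real_mat_smult
  real_mat_one real_mat_transpose real_mat_mult

lemma real_mat_pauli: "real_mat (pauli PX)" "real_mat (pauli PZ)" "real_mat (\<i> \<cdot>\<^sub>m pauli PY)"
  by (auto simp: real_mat_def pauli.simps mat_of_rows_list_def less_Suc_eq numeral_2_eq_2)

lemma kronecker_smult:
  fixes A B :: "complex mat"
  shows "(c \<cdot>\<^sub>m A) \<otimes>\<^sub>k B = c \<cdot>\<^sub>m (A \<otimes>\<^sub>k B)" "A \<otimes>\<^sub>k (c \<cdot>\<^sub>m B) = c \<cdot>\<^sub>m (A \<otimes>\<^sub>k B)"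
  by (rule eq_matI; simp add: kronecker_def div_mod_less)+

lemma real_mat_qubit_pauli:
  "real_mat (qubit_pauli n PX)" "real_mat (qubit_pauli n PZ)" "real_mat (\<i> \<cdot>\<^sub>m qubit_pauli n PY)"
proof -
  show "real_mat (qubit_pauli n PX)" "real_mat (qubit_pauli n PZ)"
    by (cases n; simp add: qubit_pauli.simps real_mat_kronecker real_mat_pauli real_mat_one)+
  show "real_mat (\<i> \<cdot>\<^sub>m qubit_pauli n PY)"
  proof (cases n)
    case Q1
    show ?thesis unfolding Q1 qubit_pauli.simps kronecker_smult(1)[symmetric]
      by (intro real_mat_kronecker real_mat_pauli real_mat_one)
  next
    case Q2
    show ?thesis unfolding Q2 qubit_pauli.simps kronecker_smult(2)[symmetric]
      by (intro real_mat_kronecker real_mat_pauli real_mat_one)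
  qed
qed

lemma real_mat_jump_op: "real_mat (jump_op \<gamma> c)"
proof -
  have c: "real_mat (collective \<gamma> PX)" "real_mat (collective \<gamma> PZ)"
    unfolding collective_def
    by (rule real_mat_smult real_mat_add real_mat_qubit_pauli | simp)+
  have "\<i> \<cdot>\<^sub>m collective \<gamma> PY =
      complex_of_real (sqrt \<gamma> / 2) \<cdot>\<^sub>m (\<i> \<cdot>\<^sub>m qubit_pauli Q1 PY + \<i> \<cdot>\<^sub>m qubit_pauli Q2 PY)"
    by (rule eq_matI) (simp_all add: collective_def algebra_simps)
  moreover have "real_mat \<dots>"
    by (rule real_mat_smult real_mat_add real_mat_qubit_pauli | simp)+
  ultimately have y: "real_mat (\<i> \<cdot>\<^sub>m collective \<gamma> PY)" by simp
  show ?thesis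
    by (cases c; simp add: jump_op.simps c y real_mat_add real_mat_minus)
qed

lemma real_mat_dissipator: "real_mat G \<Longrightarrow> real_mat (dissipator_cx G)"
  if "dim_row G = 4" "dim_col G = 4"
  unfolding dissipator_cx_def
  by (rule real_mat_intros | assumption | simp add: that)+

lemma real_mat_tilde:
  "real_mat (B_tilde_x_cx n)" "real_mat (B_tilde_y_cx n)"
  "real_mat (A_tilde_L_cx \<gamma>)" "real_mat (A_tilde_z_cx J)"
proof -
  show "real_mat (B_tilde_x_cx n)"
    unfolding B_tilde_x_cx_def ctrl_super_cx_def
    by (rule real_mat_intros real_mat_qubit_pauli | simp)+
  show "real_mat (A_tilde_L_cx \<gamma>)"
    unfolding A_tilde_L_cx_def
    by (rule real_mat_add real_mat_dissipator real_mat_jump_op | simp)+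
  show "real_mat (A_tilde_z_cx J)"
    unfolding A_tilde_z_cx_def
    by (rule real_mat_intros real_mat_qubit_pauli | simp)+
  have t: "(\<i> \<cdot>\<^sub>m qubit_pauli n PY)\<^sup>T = \<i> \<cdot>\<^sub>m (qubit_pauli n PY)\<^sup>T"
    by (rule eq_matI) simp_all
  have "B_tilde_y_cx n = (- 1 / 2) \<cdot>\<^sub>m
      (1\<^sub>m 4 \<otimes>\<^sub>k (\<i> \<cdot>\<^sub>m qubit_pauli n PY) - (\<i> \<cdot>\<^sub>m qubit_pauli n PY)\<^sup>T \<otimes>\<^sub>k 1\<^sub>m 4)"
    unfolding t kronecker_smult B_tilde_y_cx_def ctrl_super_cx_def
    by (rule eq_matI) (simp_all add: algebra_simps)
  moreover have "real_mat \<dots>"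
    by (rule real_mat_intros real_mat_qubit_pauli | simp)+
  ultimately show "real_mat (B_tilde_y_cx n)" by simp
qed

lemma of_real_Re_mat:
  "map_mat complex_of_real (B_tilde_x n) = B_tilde_x_cx n"
  "map_mat complex_of_real (B_tilde_y n) = B_tilde_y_cx n"
  "map_mat complex_of_real (A_tilde_L \<gamma>) = A_tilde_L_cx \<gamma>"
  "map_mat complex_of_real (A_tilde_z J) = A_tilde_z_cx J"
proof -
  have *: "map_mat complex_of_real (Re_mat M) = M" if "real_mat M" for M
    using that unfolding real_mat_def by (intro eq_matI) (simp_all add: complex_eq_iff)
  show
    "map_mat complex_of_real (B_tilde_x n) = B_tilde_x_cx n"
    "map_mat complex_of_real (B_tilde_y n) = B_tilde_y_cx n"
    "map_mat complex_of_real (A_tilde_L \<gamma>) = A_tilde_L_cx \<gamma>"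
    "map_mat complex_of_real (A_tilde_z J) = A_tilde_z_cx J"
    unfolding B_tilde_x_def B_tilde_y_def A_tilde_L_def A_tilde_z_def
    by (rule *, rule real_mat_tilde)+
qed

definition A_cal :: "real \<Rightarrow> real \<Rightarrow> real mat" where
  "A_cal J \<gamma> = four_block_mat (A_tilde_L \<gamma>) (- A_tilde_z J) (A_tilde_z J) (A_tilde_L \<gamma>)"

definition B_cal_x :: "qubit \<Rightarrow> real mat" where
  "B_cal_x n = four_block_mat (0\<^sub>m 16 16) (- B_tilde_x n) (B_tilde_x n) (0\<^sub>m 16 16)"

definition B_cal_y :: "qubit \<Rightarrow> real mat" where
  "B_cal_y n = four_block_mat (B_tilde_y n) (0\<^sub>m 16 16) (0\<^sub>m 16 16) (B_tilde_y n)"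

text \<open>Three-term recurrence coefficients of the normalized Legendre polynomials, and the
  matrix of multiplication by a parameter in \<open>[lo, hi]\<close> truncated at degree \<open>N\<close>.\<close>

definition legendre_coeff :: "nat \<Rightarrow> real" where
  "legendre_coeff p = (real p + 1) / sqrt ((2 * real p + 3) * (2 * real p + 1))"

definition param_mat :: "nat \<Rightarrow> real \<Rightarrow> real \<Rightarrow> real mat" where
  "param_mat N lo hi = mat (N + 1) (N + 1) (\<lambda>(i, j).
     if i = j then (hi + lo) / 2
     else if j = i + 1 then legendre_coeff i * ((hi - lo) / 2)
     else if i = j + 1 then legendre_coeff j * ((hi - lo) / 2)
     else 0)"

definition drift_mat :: "real \<Rightarrow> real \<Rightarrow> nat \<Rightarrow> real \<Rightarrow> real \<Rightarrow> nat \<Rightarrow> real mat" where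
  "drift_mat J \<gamma> N\<^sub>\<alpha> \<alpha>\<^sub>min \<alpha>\<^sub>max N\<^sub>\<beta> =
     param_mat N\<^sub>\<alpha> \<alpha>\<^sub>min \<alpha>\<^sub>max \<otimes>\<^sub>k 1\<^sub>m (N\<^sub>\<beta> + 1) \<otimes>\<^sub>k A_cal J \<gamma>"

text \<open>The four control channels are numbered in the order of the components of a control
  sample: \<open>u\<^sub>1\<^sup>x, u\<^sub>1\<^sup>y, u\<^sub>2\<^sup>x, u\<^sub>2\<^sup>y\<close>.\<close>

definition ctrl_mat :: "nat \<Rightarrow> nat \<Rightarrow> real \<Rightarrow> real \<Rightarrow> nat \<Rightarrow> real mat" where
  "ctrl_mat N\<^sub>\<alpha> N\<^sub>\<beta> \<beta>\<^sub>min \<beta>\<^sub>max c =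
     1\<^sub>m (N\<^sub>\<alpha> + 1) \<otimes>\<^sub>k param_mat N\<^sub>\<beta> \<beta>\<^sub>min \<beta>\<^sub>max
       \<otimes>\<^sub>k ([B_cal_x Q1, B_cal_y Q1, B_cal_x Q2, B_cal_y Q2] ! c)"

lemma dims_cal [simp]:
  "A_cal J \<gamma> \<in> carrier_mat 32 32" "B_cal_x n \<in> carrier_mat 32 32" "B_cal_y n \<in> carrier_mat 32 32"
proof -
  have *: "four_block_mat P R S U \<in> carrier_mat 32 32"
    if "P \<in> carrier_mat 16 16" "U \<in> carrier_mat 16 16" for P R S U :: "real mat"
    using four_block_carrier_mat[OF that] by simp
  show "A_cal J \<gamma> \<in> carrier_mat 32 32" "B_cal_x n \<in> carrier_mat 32 32"
    "B_cal_y n \<in> carrier_mat 32 32"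
    unfolding A_cal_def B_cal_x_def B_cal_y_def by (rule *; simp)+
qed

lemma no_expansion:
  "drift_mat J \<gamma> 0 \<alpha>\<^sub>min \<alpha>\<^sub>max 0 = ((\<alpha>\<^sub>max + \<alpha>\<^sub>min) / 2) \<cdot>\<^sub>m A_cal J \<gamma>"
  "ctrl_mat 0 0 \<beta>\<^sub>min \<beta>\<^sub>max c =
     ((\<beta>\<^sub>max + \<beta>\<^sub>min) / 2) \<cdot>\<^sub>m ([B_cal_x Q1, B_cal_y Q1, B_cal_x Q2, B_cal_y Q2] ! c)"
  by (rule eq_matI; simp add: drift_mat_def ctrl_mat_def param_mat_def kronecker_def)+

text \<open>In the following, \<open>A\<close> is the drift, \<open>B c\<close> the matrix of control channel \<open>c < 4\<close>, \<open>dt\<close> the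
  time step and \<open>u\<close> the stacked control vector: entry \<open>4 * k + c\<close> is channel \<open>c\<close> on the
  \<open>k\<close>-th time interval.\<close>

definition step_mat :: "real mat \<Rightarrow> (nat \<Rightarrow> real mat) \<Rightarrow> real \<Rightarrow> real vec \<Rightarrow> nat \<Rightarrow> real mat" where
  "step_mat A B dt u k = mat_exp (dt \<cdot>\<^sub>m
     (A + (u $ (4 * k) \<cdot>\<^sub>m B 0 + u $ (4 * k + 1) \<cdot>\<^sub>m B 1
         + u $ (4 * k + 2) \<cdot>\<^sub>m B 2 + u $ (4 * k + 3) \<cdot>\<^sub>m B 3)))"

text \<open>\<open>U\<^bsub>b-1\<^esub> \<cdots> U\<^bsub>a+1\<^esub> U\<^bsub>a\<^esub>\<close>, latest factor leftmost; the identity if \<open>a \<ge> b\<close>.\<close>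

definition propagator ::
  "real mat \<Rightarrow> (nat \<Rightarrow> real mat) \<Rightarrow> real \<Rightarrow> real vec \<Rightarrow> nat \<Rightarrow> nat \<Rightarrow> real mat" where
  "propagator A B dt u a b =
     foldr (\<lambda>k M. step_mat A B dt u k * M) (rev [a..<b]) (1\<^sub>m (dim_row A))"

definition terminal_state ::
  "real mat \<Rightarrow> (nat \<Rightarrow> real mat) \<Rightarrow> real \<Rightarrow> nat \<Rightarrow> real vec \<Rightarrow> real vec \<Rightarrow> real vec" where
  "terminal_state A B dt K x\<^sub>0 u = propagator A B dt u 0 K *\<^sub>v x\<^sub>0"

definition approx_deriv ::
  "real mat \<Rightarrow> (nat \<Rightarrow> real mat) \<Rightarrow> real \<Rightarrow> nat \<Rightarrow> real vec \<Rightarrow> real vec \<Rightarrow> nat \<Rightarrow> nat \<Rightarrow> real vec" where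
  "approx_deriv A B dt K x\<^sub>0 u k c =
     dt \<cdot>\<^sub>v (propagator A B dt u (k + 1) K *\<^sub>v (B c *\<^sub>v (propagator A B dt u 0 (k + 1) *\<^sub>v x\<^sub>0)))"

definition approx_jacobian ::
  "real mat \<Rightarrow> (nat \<Rightarrow> real mat) \<Rightarrow> real \<Rightarrow> nat \<Rightarrow> real vec \<Rightarrow> real vec \<Rightarrow> real mat" where
  "approx_jacobian A B dt K x\<^sub>0 u = mat_of_cols (dim_row A)
     (map (\<lambda>j. approx_deriv A B dt K x\<^sub>0 u (j div 4) (j mod 4)) [0..<4 * K])"

text \<open>Gradient, with respect to the controls, of the objective \<open>u \<mapsto> \<phi> (terminal_state \<dots> u)\<close>
  when each partial derivative of the terminal state is replaced by \<^const>\<open>approx_deriv\<close>: by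
  the chain rule, component \<open>j\<close> is the derivative of \<open>\<phi>\<close> at the terminal state in the direction
  of the \<open>j\<close>-th approximate partial derivative.\<close>

definition approx_gradient ::
  "(real vec \<Rightarrow> real) \<Rightarrow> real mat \<Rightarrow> (nat \<Rightarrow> real mat) \<Rightarrow> real \<Rightarrow> nat \<Rightarrow> real vec \<Rightarrow> real vec \<Rightarrow> real vec"
where
  "approx_gradient \<phi> A B dt K x\<^sub>0 u = vec (4 * K) (\<lambda>j.
     deriv (\<lambda>s. \<phi> (terminal_state A B dt K x\<^sub>0 u
                    + s \<cdot>\<^sub>v approx_deriv A B dt K x\<^sub>0 u (j div 4) (j mod 4))) 0)"

end

theory Submission
  imports Defs "Jordan_Normal_Form.Determinant"
begin

text \<open>Both objectives are quadratic. Completing the square at the claimed optimizer \<open>w\<close>, where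
  the gradient vanishes, shows that moving from \<open>w\<close> to \<open>v\<close> costs at least
  \<open>(\<lambda>/2) \<parallel>v - w\<parallel>\<^sup>2\<close>, so \<open>w\<close> is the unique optimizer. The matrix \<open>Q\<^sup>T Q + \<lambda> I\<close> is invertible
  because \<open>v \<bullet> (Q\<^sup>T Q + \<lambda> I) v = \<parallel>Q v\<parallel>\<^sup>2 + \<lambda> \<parallel>v\<parallel>\<^sup>2\<close> is positive for \<open>v \<noteq> 0\<close>. Nothing specific to
  the two-qubit system matters beyond the dimension of \<open>Q\<close>.\<close>

section \<open>Unique optimizers of real functions\<close>

text \<open>\<open>is_arg_min\<close> only forbids strictly smaller values. A strict comparison with
  every other feasible point also excludes ties, so the equivalence gives existence and uniqueness
  at once.\<close>

lemma is_arg_min_unique_iff: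
  fixes f :: "'a \<Rightarrow> real"
  assumes "P w" and "\<And>v. P v \<Longrightarrow> v \<noteq> w \<Longrightarrow> f w < f v"
  shows "is_arg_min f P x \<longleftrightarrow> x = w"
  using assms unfolding is_arg_min_def by (metis less_asym)

lemma is_arg_min_cong:
  assumes "\<And>v. P v \<Longrightarrow> f v = g v"
  shows "is_arg_min f P x \<longleftrightarrow> is_arg_min g P x"
  using assms unfolding is_arg_min_def by metis

lemma is_arg_max_unique_iff:
  fixes f :: "'a \<Rightarrow> real"
  assumes "P w" and "\<And>v. P v \<Longrightarrow> v \<noteq> w \<Longrightarrow> f v < f w"
  shows "is_arg_max f P x \<longleftrightarrow> x = w"
  using assms unfolding is_arg_max_def by (metis less_asym)

section \<open>Squared norms of real vectors\<close>

lemma scalar_prod_self_nonneg: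
  fixes v :: "real vec"
  shows "0 \<le> v \<bullet> v"
  using conjugate_square_ge_0_vec[of v] by simp

lemma euclid_norm_square: "(euclid_norm v)\<^sup>2 = v \<bullet> v"
  by (simp add: euclid_norm_def scalar_prod_self_nonneg)

lemma scalar_prod_self_pos:
  fixes v :: "real vec"
  assumes "v \<in> carrier_vec n" and "v \<noteq> 0\<^sub>v n"
  shows "0 < v \<bullet> v"
  using conjugate_square_greater_0_vec[OF assms(1)] assms(2) by simp

lemma scalar_prod_self_add:
  fixes v w :: "real vec"
  assumes "v \<in> carrier_vec n" and "w \<in> carrier_vec n"
  shows "(v + w) \<bullet> (v + w) = v \<bullet> v + 2 * (v \<bullet> w) + w \<bullet> w"
  using assms comm_scalar_prod[OF assms]
  by (simp add: add_scalar_prod_distrib[of _ n] scalar_prod_add_distrib[of _ n])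

section \<open>The two quadratic programs\<close>

text \<open>With \<open>w\<close> the claimed maximizer, the linear term is
  \<open>lam * (w \<bullet> v)\<close>. At \<open>w + e\<close> the first-order terms in
  \<open>e\<close> cancel and the objective drops by exactly
  \<open>lam/2 * (e \<bullet> e)\<close>.\<close>

lemma is_arg_max_linear_minus_square:
  fixes Q :: "real mat"
  assumes Q: "Q \<in> carrier_mat n m" and x: "x \<in> carrier_vec n" and lam: "lam > 0"
  shows "is_arg_max (\<lambda>v. x \<bullet> (Q *\<^sub>v v) - 1/2 * lam * (euclid_norm v)\<^sup>2)
           (\<lambda>v. v \<in> carrier_vec m) y
         \<longleftrightarrow> y = (1 / lam) \<cdot>\<^sub>v (Q\<^sup>T *\<^sub>v x)"
proof -
  define w where "w = (1 / lam) \<cdot>\<^sub>v (Q\<^sup>T *\<^sub>v x)"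
  have w: "w \<in> carrier_vec m" using Q x by (simp add: w_def)
  have lin: "x \<bullet> (Q *\<^sub>v v) = lam * (w \<bullet> v)" if v: "v \<in> carrier_vec m" for v
    using transpose_vec_mult_scalar[OF Q v x] lam Q x v
    by (simp add: w_def)
  show ?thesis
    unfolding w_def[symmetric]
  proof (rule is_arg_max_unique_iff)
    fix v assume v: "v \<in> carrier_vec m" and ne: "v \<noteq> w"
    define e where "e = v - w"
    have e: "e \<in> carrier_vec m" using v w by (simp add: e_def)
    have ve: "v = w + e" using v w by (auto simp: e_def)
    have "e \<noteq> 0\<^sub>v m" using ne ve w by auto
    then have pos: "0 < lam * (e \<bullet> e)" using scalar_prod_self_pos[OF e] lam by simp
    have "w \<bullet> v = w \<bullet> w + w \<bullet> e"
      unfolding ve using w e by (simp add: scalar_prod_add_distrib[of _ m])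
    with pos show "x \<bullet> (Q *\<^sub>v v) - 1/2 * lam * (euclid_norm v)\<^sup>2
        < x \<bullet> (Q *\<^sub>v w) - 1/2 * lam * (euclid_norm w)\<^sup>2"
      unfolding lin[OF v] lin[OF w] euclid_norm_square
      using scalar_prod_self_add[OF w e] ve by (simp add: algebra_simps)
  qed (rule w)
qed

text \<open>The minimizer is characterized by a vanishing gradient, so no inverse matrix enters
  here. The excess at \<open>w + e\<close> is half the squared norm of \<open>Q *\<^sub>v e\<close>
  plus \<open>lam/2 * (e \<bullet> e)\<close>.\<close>

lemma is_arg_min_regularized_least_squares:
  fixes Q :: "real mat"
  assumes Q: "Q \<in> carrier_mat n m" and r: "r \<in> carrier_vec n" and lam: "lam > 0"
    and w: "w \<in> carrier_vec m"
    and normal_eq: "Q\<^sup>T *\<^sub>v (Q *\<^sub>v w + r) + lam \<cdot>\<^sub>v w = 0\<^sub>v m"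
  shows "is_arg_min (\<lambda>v. 1/2 * (euclid_norm (Q *\<^sub>v v + r))\<^sup>2 + 1/2 * lam * (euclid_norm v)\<^sup>2)
           (\<lambda>v. v \<in> carrier_vec m) y
         \<longleftrightarrow> y = w"
proof (rule is_arg_min_unique_iff)
  fix v assume v: "v \<in> carrier_vec m" and ne: "v \<noteq> w"
  define e where "e = v - w"
  define p where "p = Q *\<^sub>v w + r"
  have e: "e \<in> carrier_vec m" using v w by (simp add: e_def)
  have ve: "v = w + e" using v w by (auto simp: e_def)
  have p: "p \<in> carrier_vec n" and Qe: "Q *\<^sub>v e \<in> carrier_vec n"
    using Q w e r by (simp_all add: p_def)
  have "e \<noteq> 0\<^sub>v m" using ne ve w by auto
  then have pos: "0 < lam * (e \<bullet> e)" using scalar_prod_self_pos[OF e] lam by simp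
  have res: "Q *\<^sub>v v + r = p + Q *\<^sub>v e"
    unfolding ve p_def using Q w e r
    by (intro eq_vecI) (auto simp: mult_add_distrib_mat_vec[of _ n m])
  \<comment> \<open>Pairing the gradient at \<open>w\<close> with the displacement \<open>e\<close>
    yields exactly the cross terms of the two expanded squares.\<close>
  have "(Q\<^sup>T *\<^sub>v p + lam \<cdot>\<^sub>v w) \<bullet> e = p \<bullet> (Q *\<^sub>v e) + lam * (w \<bullet> e)"
    using transpose_vec_mult_scalar[OF Q e p] Q p w e
    by (simp add: add_scalar_prod_distrib[of _ m])
  then have cross: "p \<bullet> (Q *\<^sub>v e) + lam * (w \<bullet> e) = 0"
    using normal_eq e by (simp add: p_def)
  have "1/2 * (p \<bullet> p) + 1/2 * lam * (w \<bullet> w)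
      < 1/2 * ((p + Q *\<^sub>v e) \<bullet> (p + Q *\<^sub>v e)) + 1/2 * lam * (v \<bullet> v)"
    using scalar_prod_self_add[OF w e] scalar_prod_self_add[OF p Qe] ve cross pos
      scalar_prod_self_nonneg[of "Q *\<^sub>v e"]
    by (simp add: algebra_simps)
  then show "1/2 * (euclid_norm (Q *\<^sub>v w + r))\<^sup>2 + 1/2 * lam * (euclid_norm w)\<^sup>2
      < 1/2 * (euclid_norm (Q *\<^sub>v v + r))\<^sup>2 + 1/2 * lam * (euclid_norm v)\<^sup>2"
    by (simp add: euclid_norm_square res p_def)
qed (rule w)

section \<open>Invertibility of the regularized Gram matrix\<close>

lemma regularized_gram_mult_vec:
  fixes Q :: "real mat"
  assumes "Q \<in> carrier_mat n m" and "v \<in> carrier_vec m"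
  shows "(Q\<^sup>T * Q + lam \<cdot>\<^sub>m 1\<^sub>m m) *\<^sub>v v = Q\<^sup>T *\<^sub>v (Q *\<^sub>v v) + lam \<cdot>\<^sub>v v"
proof -
  have "(lam \<cdot>\<^sub>m 1\<^sub>m m) *\<^sub>v v = lam \<cdot>\<^sub>v v"
    using assms by (intro eq_vecI) auto
  moreover have "(Q\<^sup>T * Q + lam \<cdot>\<^sub>m 1\<^sub>m m) *\<^sub>v v = (Q\<^sup>T * Q) *\<^sub>v v + (lam \<cdot>\<^sub>m 1\<^sub>m m) *\<^sub>v v"
    using assms by (intro add_mult_distrib_mat_vec[of _ m m]) auto
  moreover have "(Q\<^sup>T * Q) *\<^sub>v v = Q\<^sup>T *\<^sub>v (Q *\<^sub>v v)"
    using assms by (intro assoc_mult_mat_vec[of _ m n]) auto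
  ultimately show ?thesis by simp
qed

lemma regularized_gram_inverse:
  fixes Q :: "real mat"
  assumes Q: "Q \<in> carrier_mat n m" and lam: "lam > 0"
  obtains R where "mat_inverse (Q\<^sup>T * Q + lam \<cdot>\<^sub>m 1\<^sub>m m) = Some R"
    and "R \<in> carrier_mat m m" and "(Q\<^sup>T * Q + lam \<cdot>\<^sub>m 1\<^sub>m m) * R = 1\<^sub>m m"
proof -
  define M where "M = Q\<^sup>T * Q + lam \<cdot>\<^sub>m 1\<^sub>m m"
  have M: "M \<in> carrier_mat m m" using Q by (simp add: M_def)
  have "det M \<noteq> 0"
  proof
    \<comment> \<open>A singular \<open>M\<close> has a nonzero kernel vector, which contradicts
      positive definiteness.\<close>
    assume "det M = 0"
    then obtain v where v: "v \<in> carrier_vec m" "v \<noteq> 0\<^sub>v m" and Mv: "M *\<^sub>v v = 0\<^sub>v m"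
      using det_0_iff_vec_prod_zero_field[OF M] by blast
    have Qv: "Q *\<^sub>v v \<in> carrier_vec n" using Q v(1) by (rule mult_mat_vec_carrier)
    have "(M *\<^sub>v v) \<bullet> v = (Q\<^sup>T *\<^sub>v (Q *\<^sub>v v)) \<bullet> v + lam * (v \<bullet> v)"
      unfolding M_def regularized_gram_mult_vec[OF Q v(1)]
      using Q Qv v(1) by (simp add: add_scalar_prod_distrib[of _ m])
    also have "(Q\<^sup>T *\<^sub>v (Q *\<^sub>v v)) \<bullet> v = (Q *\<^sub>v v) \<bullet> (Q *\<^sub>v v)"
      by (rule transpose_vec_mult_scalar[OF Q v(1) Qv])
    finally have "(Q *\<^sub>v v) \<bullet> (Q *\<^sub>v v) + lam * (v \<bullet> v) = 0" using v(1) Mv by simp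
    moreover have "lam * (v \<bullet> v) > 0" using scalar_prod_self_pos[OF v] lam by simp
    ultimately show False using scalar_prod_self_nonneg[of "Q *\<^sub>v v"] by linarith
  qed
  then have "M \<in> Units (ring_mat TYPE(real) m ())" by (rule det_non_zero_imp_unit[OF M])
  \<comment> \<open>The outcome \<open>None\<close> would make \<open>M\<close> a non-unit of the
    matrix ring.\<close>
  then obtain R where "mat_inverse M = Some R"
    using mat_inverse(1)[OF M, of "()"] by (cases "mat_inverse M") auto
  with mat_inverse(2)[OF M this] show thesis using that unfolding M_def by blast
qed

section \<open>Dimensions of propagators, states and the Jacobian\<close>

text \<open>Matrix addition takes its dimensions from the right operand, so the nested sum inherits
  those of its last summand, the multiple of \<open>B 3\<close>.\<close>

lemma step_mat_carrier:
  "B 3 \<in> carrier_mat n n \<Longrightarrow> step_mat A B dt u k \<in> carrier_mat n n"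
  by (simp add: step_mat_def mat_exp_def)

lemma propagator_carrier:
  assumes "A \<in> carrier_mat n n" and "B 3 \<in> carrier_mat n n"
  shows "propagator A B dt u a b \<in> carrier_mat n n"
proof -
  have "foldr (\<lambda>k M. step_mat A B dt u k * M) ks (1\<^sub>m n) \<in> carrier_mat n n" for ks
  proof (induction ks)
    case (Cons k ks)
    show ?case
      using mult_carrier_mat[OF step_mat_carrier[where B = B, OF assms(2)] Cons] by simp
  qed simp
  then show ?thesis using assms(1) by (simp add: propagator_def)
qed

text \<open>A matrix-vector product has as many entries as the matrix has rows, so the leftmost
  propagator fixes the dimension.\<close>

lemma approx_deriv_carrier:
  assumes "A \<in> carrier_mat n n" and "B 3 \<in> carrier_mat n n"
  shows "approx_deriv A B dt K x\<^sub>0 u k c \<in> carrier_vec n"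
  using carrier_matD(1)[OF propagator_carrier[where B = B, OF assms]]
  by (intro carrier_vecI) (simp add: approx_deriv_def)

lemma terminal_state_carrier:
  assumes "A \<in> carrier_mat n n" and "B 3 \<in> carrier_mat n n"
  shows "terminal_state A B dt K x\<^sub>0 u \<in> carrier_vec n"
  using carrier_matD(1)[OF propagator_carrier[where B = B, OF assms]]
  by (intro carrier_vecI) (simp add: terminal_state_def)

lemma approx_jacobian_carrier:
  "A \<in> carrier_mat n n \<Longrightarrow> approx_jacobian A B dt K x\<^sub>0 u \<in> carrier_mat n (4 * K)"
  by (rule carrier_matI) (simp_all add: approx_jacobian_def)

section \<open>The approximate gradient of a linear objective\<close>

text \<open>Along the \<open>j\<close>-th approximate partial derivative the objective is affine in
  \<open>s\<close> with slope \<open>y \<bullet> d j\<close>. Since \<open>d j\<close> is column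
  \<open>j\<close> of the Jacobian, these slopes form the transpose applied to \<open>y\<close>.
  This identifies the maximizer with a gradient step.\<close>

lemma approx_gradient_linear:
  assumes A: "A \<in> carrier_mat n n" and B: "B 3 \<in> carrier_mat n n" and y: "y \<in> carrier_vec n"
  shows "approx_gradient (\<lambda>x. y \<bullet> x) A B dt K x\<^sub>0 u = (approx_jacobian A B dt K x\<^sub>0 u)\<^sup>T *\<^sub>v y"
proof -
  define Q where "Q = approx_jacobian A B dt K x\<^sub>0 u"
  define x where "x = terminal_state A B dt K x\<^sub>0 u"
  define d where "d j = approx_deriv A B dt K x\<^sub>0 u (j div 4) (j mod 4)" for j
  have Q: "Q \<in> carrier_mat n (4 * K)" unfolding Q_def by (rule approx_jacobian_carrier[OF A])
  have x: "x \<in> carrier_vec n" unfolding x_def by (rule terminal_state_carrier[where B = B, OF A B])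
  have d: "d j \<in> carrier_vec n" for j
    unfolding d_def by (rule approx_deriv_carrier[where B = B, OF A B])
  have deriv: "deriv (\<lambda>s. y \<bullet> (x + s \<cdot>\<^sub>v d j)) 0 = y \<bullet> d j" for j
  proof -
    have "y \<bullet> (x + s \<cdot>\<^sub>v d j) = y \<bullet> x + s * (y \<bullet> d j)" for s
      using scalar_prod_add_distrib[OF y x, of "s \<cdot>\<^sub>v d j"] scalar_prod_smult_distrib[OF y d, of s j]
        d[of j] by simp
    moreover have "((\<lambda>s. y \<bullet> x + s * (y \<bullet> d j)) has_field_derivative y \<bullet> d j) (at 0)"
      by (auto intro!: derivative_eq_intros)
    ultimately show ?thesis by (simp add: DERIV_imp_deriv)
  qed
  have col: "col Q j = d j" if "j < 4 * K" for j
  proof -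
    have "col Q j = map d [0..<4 * K] ! j"
      unfolding Q_def approx_jacobian_def d_def[symmetric] carrier_matD(1)[OF A]
      using that d by (intro col_mat_of_cols) auto
    then show ?thesis using that by simp
  qed
  have "approx_gradient (\<lambda>x. y \<bullet> x) A B dt K x\<^sub>0 u = vec (4 * K) (\<lambda>j. y \<bullet> d j)"
    unfolding approx_gradient_def x_def[symmetric] d_def[symmetric] deriv ..
  also have "\<dots> = Q\<^sup>T *\<^sub>v y"
    using Q col comm_scalar_prod[OF y d] by (intro eq_vecI) auto
  finally show ?thesis unfolding Q_def .
qed

theorem proposition1:
  fixes J \<gamma> \<alpha>\<^sub>min \<alpha>\<^sub>max \<beta>\<^sub>min \<beta>\<^sub>max T dt lam :: real
    and K N\<^sub>\<alpha> N\<^sub>\<beta> :: nat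
    and A Q :: "real mat" and B :: "nat \<Rightarrow> real mat"
    and x\<^sub>0 x\<^sub>T x\<^sub>K u :: "real vec"
  assumes "\<gamma> \<ge> 0" and "\<alpha>\<^sub>min \<le> \<alpha>\<^sub>max" and "\<beta>\<^sub>min \<le> \<beta>\<^sub>max"
    and "T > 0" and "K \<ge> 1" and "dt = T / real K" and "lam > 0"
    and "N\<^sub>\<alpha> = 0" and "N\<^sub>\<beta> = 0"
    and "A = drift_mat J \<gamma> N\<^sub>\<alpha> \<alpha>\<^sub>min \<alpha>\<^sub>max N\<^sub>\<beta>"
    and "B = ctrl_mat N\<^sub>\<alpha> N\<^sub>\<beta> \<beta>\<^sub>min \<beta>\<^sub>max"
    and "x\<^sub>0 \<in> carrier_vec 32" and "x\<^sub>T \<in> carrier_vec 32" and "u \<in> carrier_vec (4 * K)"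
    and "x\<^sub>K = terminal_state A B dt K x\<^sub>0 u"
    and "Q = approx_jacobian A B dt K x\<^sub>0 u"
  shows
    "(\<forall>\<delta>u. is_arg_max (\<lambda>v. x\<^sub>T \<bullet> (Q *\<^sub>v v) - 1/2 * lam * (euclid_norm v)\<^sup>2)
                       (\<lambda>v. v \<in> carrier_vec (4 * K)) \<delta>u
        \<longleftrightarrow> \<delta>u = (1 / lam) \<cdot>\<^sub>v (Q\<^sup>T *\<^sub>v x\<^sub>T))
     \<and> (1 / lam) \<cdot>\<^sub>v (Q\<^sup>T *\<^sub>v x\<^sub>T)
         = (1 / lam) \<cdot>\<^sub>v approx_gradient (\<lambda>x. x\<^sub>T \<bullet> x) A B dt K x\<^sub>0 u
     \<and> (\<exists>R. mat_inverse (Q\<^sup>T * Q + lam \<cdot>\<^sub>m 1\<^sub>m (4 * K)) = Some R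
          \<and> (\<forall>\<delta>u. is_arg_min (\<lambda>v. 1/2 * (euclid_norm (Q *\<^sub>v v + x\<^sub>K - x\<^sub>T))\<^sup>2
                                      + 1/2 * lam * (euclid_norm v)\<^sup>2)
                                (\<lambda>v. v \<in> carrier_vec (4 * K)) \<delta>u
               \<longleftrightarrow> \<delta>u = - (R *\<^sub>v (Q\<^sup>T *\<^sub>v (x\<^sub>K - x\<^sub>T)))))"
proof -
  \<comment> \<open>Without expansion both matrices are scalar multiples of 32 by 32 blocks; channel
    3 is \<open>B_cal_y Q2\<close>.\<close>
  have A: "A \<in> carrier_mat 32 32" and B: "B 3 \<in> carrier_mat 32 32"
    using assms(8-11) by (simp_all add: no_expansion)
  have Q: "Q \<in> carrier_mat 32 (4 * K)" using assms(16) approx_jacobian_carrier[OF A] by simp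
  have xK: "x\<^sub>K \<in> carrier_vec 32" using assms(15) terminal_state_carrier[where B = B, OF A B] by simp
  note xT = \<open>x\<^sub>T \<in> carrier_vec 32\<close> and lam = \<open>lam > 0\<close>
  define r where "r = x\<^sub>K - x\<^sub>T"
  have r: "r \<in> carrier_vec 32" using xK xT by (simp add: r_def)
  define M where "M = Q\<^sup>T * Q + lam \<cdot>\<^sub>m 1\<^sub>m (4 * K)"
  have M: "M \<in> carrier_mat (4 * K) (4 * K)" using Q by (simp add: M_def)
  obtain R where inv: "mat_inverse M = Some R" and R: "R \<in> carrier_mat (4 * K) (4 * K)"
    and MR: "M * R = 1\<^sub>m (4 * K)"
    using regularized_gram_inverse[OF Q lam] unfolding M_def by blast
  define g where "g = Q\<^sup>T *\<^sub>v r"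
  have g: "g \<in> carrier_vec (4 * K)" using Q r by (simp add: g_def)
  define w where "w = - (R *\<^sub>v g)"
  have w: "w \<in> carrier_vec (4 * K)" using R g by (simp add: w_def)
  have "M *\<^sub>v w = - (M *\<^sub>v (R *\<^sub>v g))"
    unfolding w_def using M R by (intro eq_vecI) auto
  also have "M *\<^sub>v (R *\<^sub>v g) = g"
    using assoc_mult_mat_vec[OF M R g] MR g by simp
  finally have Mw: "M *\<^sub>v w = - g" .
  have Qw: "Q *\<^sub>v w \<in> carrier_vec 32" using Q w by simp
  \<comment> \<open>The gradient of the regularized objective at \<open>w\<close> regroups as
    \<open>M *\<^sub>v w + g\<close>, which vanishes because \<open>w\<close> solves the linear
    system with right-hand side \<open>- g\<close>.\<close>
  have "Q\<^sup>T *\<^sub>v (Q *\<^sub>v w + r) + lam \<cdot>\<^sub>v w = M *\<^sub>v w + g"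
    unfolding M_def g_def regularized_gram_mult_vec[OF Q w]
      mult_add_distrib_mat_vec[OF transpose_carrier_mat[THEN iffD2, OF Q] Qw r]
    using Q Qw r w by (intro eq_vecI) auto
  also have "\<dots> = 0\<^sub>v (4 * K)" using Mw g by simp
  finally have normal_eq: "Q\<^sup>T *\<^sub>v (Q *\<^sub>v w + r) + lam \<cdot>\<^sub>v w = 0\<^sub>v (4 * K)" .
  \<comment> \<open>The residual parses as a sum minus \<open>x\<^sub>T\<close>; it is regrouped so
    that the constant part is the single vector \<open>r\<close>.\<close>
  have res: "Q *\<^sub>v v + x\<^sub>K - x\<^sub>T = Q *\<^sub>v v + r" if "v \<in> carrier_vec (4 * K)" for v
    using Q xK xT that by (intro eq_vecI) (auto simp: r_def)
  have "is_arg_min (\<lambda>v. 1/2 * (euclid_norm (Q *\<^sub>v v + x\<^sub>K - x\<^sub>T))\<^sup>2 + 1/2 * lam * (euclid_norm v)\<^sup>2)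
      (\<lambda>v. v \<in> carrier_vec (4 * K)) \<delta>u \<longleftrightarrow> \<delta>u = w" for \<delta>u
    \<comment> \<open>The equation \<open>\<delta>u = w\<close> is turned back into a minimality
      statement, so that only two pointwise equal objectives remain to be compared.\<close>
    unfolding is_arg_min_regularized_least_squares[OF Q r lam w normal_eq, symmetric]
    by (rule is_arg_min_cong) (simp only: res)
  then have "\<exists>R. mat_inverse (Q\<^sup>T * Q + lam \<cdot>\<^sub>m 1\<^sub>m (4 * K)) = Some R
      \<and> (\<forall>\<delta>u. is_arg_min (\<lambda>v. 1/2 * (euclid_norm (Q *\<^sub>v v + x\<^sub>K - x\<^sub>T))\<^sup>2
            + 1/2 * lam * (euclid_norm v)\<^sup>2) (\<lambda>v. v \<in> carrier_vec (4 * K)) \<delta>u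
          \<longleftrightarrow> \<delta>u = - (R *\<^sub>v (Q\<^sup>T *\<^sub>v (x\<^sub>K - x\<^sub>T))))"
    using inv unfolding w_def g_def r_def M_def by (intro exI[of _ R] conjI allI)
  moreover have "(1 / lam) \<cdot>\<^sub>v (Q\<^sup>T *\<^sub>v x\<^sub>T)
      = (1 / lam) \<cdot>\<^sub>v approx_gradient (\<lambda>x. x\<^sub>T \<bullet> x) A B dt K x\<^sub>0 u"
    unfolding assms(16) approx_gradient_linear[where B = B, OF A B xT] by (rule refl)
  ultimately show ?thesis
    by (intro conjI allI is_arg_max_linear_minus_square[OF Q xT lam])
qed

end
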